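(* Let $A$ be an $n\times n$ pseudo principal matrix of $\mathbf{a}=(a_1,\dots,a_n)$, where the $a_i$ are positive integers, and suppose $\operatorname{rank} A=n-p\le n-2$. Then there exist integers $r_1,\dots,r_p\ge 2$ with $\sum_{i=1}^p r_i\le n$ such that, after a possible reordering of $a_1,\dots,a_n$ (with the corresponding simultaneous permutation of the rows and columns of $A$), $\mathbf{a}$ splits into consecutive disjoint parts $\mathbf{a}=\mathbf{r}_1\sqcup\mathbf{r}_2\sqcup\dots\sqcup\mathbf{r}_p\sqcup\mathbf{r}_{p+1}$ with $|\mathbf{r}_i|=r_i$ for $1\le i\le p$ ($\mathbf{r}_{p+1}$ being possibly empty), and $$A=\begin{bmatrix} D & \mathbf{0}\\ A_1& A_2\end{bmatrix},$$ where $D$ is the concatenation (block diagonal matrix) of matrices $P(\mathbf{r}_1),\dots,P(\mathbf{r}_p)$, each $P(\mathbf{r}_i)$ being an $r_i\times r_i$ pseudo principal matrix of $\mathbf{r}_i$. Moreover, if $A$ is a principal matrix of $\mathbf{a}$, then $D$ is the concatenation of matrices $D(\mathbf{r}_1),\dots,D(\mathbf{r}_p)$, where $D(\mathbf{r}_i)$ is a principal matrix of $\mathbf{r}_i$.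
   Context: An $n\times n$ integer matrix $A=(a_{ij})$ is called pseudo principal if $a_{ii}<0$ for all $i$, $a_{ij}\ge 0$ for all $i\ne j$, and there exist positive integers $a_1,\dots,a_n$ such that $A(a_1,\dots,a_n)^T=0$; one then says $A$ is a pseudo principal matrix of $\mathbf{a}=(a_1,\dots,a_n)$ and writes $A=P(\mathbf{a})$. For a set $\mathbf{a}=\{a_1,\dots,a_n\}$ of positive integers, $\langle \mathbf{a}\rangle$ denotes the additive monoid of all non-negative integer combinations of the $a_i$. If $\mathbf{a}$ minimally generates $\langle\mathbf{a}\rangle$, a principal matrix of $\mathbf{a}$, written $D(\mathbf{a})$, is an $n\times n$ integer matrix with diagonal entries $-c_1,\dots,-c_n$ and non-negative off-diagonal entries $a_{ij}$ such that $A(a_1,\dots,a_n)^T=0$ and, for each $i$, $c_i$ is the smallest positive integer with $c_ia_i\in\langle \mathbf{a}\setminus\{a_i\}\rangle$. The concatenation of square matrices is the block diagonal matrix having them as its diagonal blocks. *)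

theory Defs
  imports Jordan_Normal_Form.DL_Rank
begin

text \<open>
  A family \<open>a = (a\<^sub>1, \<dots>, a\<^sub>n)\<close> is an integer vector (indexed from 0), so that the order of its
  entries and possible repetitions are recorded; its underlying set is \<^term>\<open>set\<^sub>v a\<close>.
\<close>

text \<open>The additive monoid generated by \<open>S\<close>; only meaningful for finite \<open>S\<close>.\<close>

definition gen_monoid :: "int set \<Rightarrow> int set" where
  "gen_monoid S = {\<Sum>x\<in>S. int (k x) * x | k :: int \<Rightarrow> nat. True}"

text \<open>Distinctness is what makes \<open>a\<close> an enumeration of the set \<open>{a\<^sub>1, \<dots>, a\<^sub>n}\<close>.\<close>

definition minimally_generates :: "int vec \<Rightarrow> bool" where
  "minimally_generates a \<longleftrightarrow>
     distinct (list_of_vec a) \<and>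
     (\<forall>B. B \<subset> set\<^sub>v a \<longrightarrow> gen_monoid B \<noteq> gen_monoid (set\<^sub>v a))"

definition pseudo_principal_matrix :: "int vec \<Rightarrow> int mat \<Rightarrow> bool" where
  "pseudo_principal_matrix a A \<longleftrightarrow>
     (let n = dim_vec a in
       A \<in> carrier_mat n n \<and>
       (\<forall>i<n. A $$ (i, i) < 0) \<and>
       (\<forall>i<n. \<forall>j<n. i \<noteq> j \<longrightarrow> 0 \<le> A $$ (i, j)) \<and>
       (\<forall>i<n. 0 < a $ i) \<and>
       A *\<^sub>v a = 0\<^sub>v n)"

definition smallest_multiplier :: "int vec \<Rightarrow> nat \<Rightarrow> int \<Rightarrow> bool" where
  "smallest_multiplier a i c \<longleftrightarrow>
     0 < c \<and> c * a $ i \<in> gen_monoid (set\<^sub>v a - {a $ i}) \<and>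
     (\<forall>d. 0 < d \<and> d * a $ i \<in> gen_monoid (set\<^sub>v a - {a $ i}) \<longrightarrow> c \<le> d)"

definition principal_matrix :: "int vec \<Rightarrow> int mat \<Rightarrow> bool" where
  "principal_matrix a A \<longleftrightarrow>
     (let n = dim_vec a in
       (\<forall>i<n. 0 < a $ i) \<and>
       minimally_generates a \<and>
       A \<in> carrier_mat n n \<and>
       (\<forall>i<n. smallest_multiplier a i (- A $$ (i, i))) \<and>
       (\<forall>i<n. \<forall>j<n. i \<noteq> j \<longrightarrow> 0 \<le> A $$ (i, j)) \<and>
       A *\<^sub>v a = 0\<^sub>v n)"

definition int_mat_rank :: "int mat \<Rightarrow> nat" where
  "int_mat_rank A = vec_space.rank (dim_row A) (map_mat rat_of_int A)"

definition reorder_vec :: "(nat \<Rightarrow> nat) \<Rightarrow> 'a vec \<Rightarrow> 'a vec" where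
  "reorder_vec \<pi> v = vec (dim_vec v) (\<lambda>i. v $ \<pi> i)"

definition reorder_mat :: "(nat \<Rightarrow> nat) \<Rightarrow> 'a mat \<Rightarrow> 'a mat" where
  "reorder_mat \<pi> A = mat (dim_row A) (dim_col A) (\<lambda>(i, j). A $$ (\<pi> i, \<pi> j))"

end

theory Submission
  imports Defs
begin

text \<open>
  Call a set \<open>C\<close> of indices closed if \<open>A\<close> has no nonzero entry in a row from \<open>C\<close> and a column
  outside \<open>C\<close>. Minimal nonempty closed sets are pairwise disjoint, and each of them carries a
  pseudo principal block. If \<open>A x = 0\<close>, then the indices at which \<open>x\<^sub>i / a\<^sub>i\<close> is maximal form a closed
  set (maximum principle), so a kernel vector vanishing at one representative of every minimal
  closed set is zero. Hence there are at least \<open>n - rank A = p\<close> minimal closed sets, and any \<open>p\<close> of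
  them give the decomposition. The multiples \<open>c\<^sub>i a\<^sub>i\<close> of a block lie in the monoid of the block by
  the block relations, and minimality of \<open>c\<^sub>i\<close> is inherited from the larger monoid.
\<close>

section \<open>Rank bounded below by independent columns\<close>

text \<open>A combination of the columns in \<open>J\<close> is \<open>A x\<close> with
  \<open>x\<close> supported on \<open>J\<close>, so the hypothesis on the kernel makes these
  columns pairwise distinct and linearly independent.\<close>

lemma (in vec_space) rank_ge_card_cols:
  assumes A: "A \<in> carrier_mat n nc" and J: "J \<subseteq> {..<nc}"
    and ker: "\<And>x. x \<in> carrier_vec nc \<Longrightarrow> A *\<^sub>v x = 0\<^sub>v n \<Longrightarrow> (\<forall>j\<in>{..<nc} - J. x $ j = 0) \<Longrightarrow> x = 0\<^sub>v nc"
  shows "card J \<le> rank A"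
proof -
  have inj: "inj_on (col A) J"
  proof
    fix j k assume jk: "j \<in> J" "k \<in> J" and eq: "col A j = col A k"
    with J have lt: "j < nc" "k < nc" by auto
    show "j = k"
    proof (rule ccontr)
      assume "j \<noteq> k"
      \<comment> \<open>Independence concerns the set of columns, so coinciding columns are excluded
        first: they would put this nonzero vector, supported on \<open>J\<close>, into the
        kernel.\<close>
      define x where "x = (unit_vec nc j - unit_vec nc k :: 'a vec)"
      have "A *\<^sub>v x = A *\<^sub>v unit_vec nc j - A *\<^sub>v unit_vec nc k"
        unfolding x_def by (rule mult_minus_distrib_mat_vec[OF A]) auto
      also have "\<dots> = col A j - col A k"
        using A lt by (auto simp: scalar_prod_right_unit)
      also have "\<dots> = 0\<^sub>v n" using A eq by auto
      finally have "A *\<^sub>v x = 0\<^sub>v n" .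
      moreover have "\<forall>i\<in>{..<nc} - J. x $ i = 0" using jk lt by (auto simp: x_def)
      ultimately have "x = 0\<^sub>v nc" by (intro ker) (auto simp: x_def)
      then have "x $ j = 0" using lt by simp
      then show False using lt \<open>j \<noteq> k\<close> by (simp add: x_def)
    qed
  qed
  have fin: "finite J" using J finite_subset by blast
  have sub: "col A ` J \<subseteq> set (cols A)" using A J by (auto simp: cols_def)
  have carr: "col A ` J \<subseteq> carrier_vec n" using A by auto
  have "lin_indpt (col A ` J)"
  proof (rule finite_lin_indpt2[OF _ carr])
    fix c :: "'a vec \<Rightarrow> 'a" assume zero: "lincomb c (col A ` J) = 0\<^sub>v n"
    \<comment> \<open>Coefficients move from columns to indices; off \<open>J\<close> they are 0, as
      the kernel hypothesis demands.\<close>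
    define x where "x = vec nc (\<lambda>j. if j \<in> J then c (col A j) else 0)"
    have "A *\<^sub>v x = 0\<^sub>v n"
    proof (rule eq_vecI)
      fix i assume "i < dim_vec (0\<^sub>v n :: 'a vec)"
      then have i: "i < n" by simp
      have "(A *\<^sub>v x) $ i = (\<Sum>j\<in>{..<nc}. A $$ (i, j) * (if j \<in> J then c (col A j) else 0))"
        using A i by (simp add: scalar_prod_def x_def atLeast0LessThan)
      also have "\<dots> = (\<Sum>j\<in>J. A $$ (i, j) * c (col A j))"
        using J by (intro sum.mono_neutral_cong_right) auto
      also have "\<dots> = (\<Sum>j\<in>J. c (col A j) * col A j $ i)"
        using J A i by (intro sum.cong) (auto simp: mult.commute)
      also have "\<dots> = lincomb c (col A ` J) $ i"
        by (simp add: lincomb_index[OF i carr] sum.reindex[OF inj])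
      finally show "(A *\<^sub>v x) $ i = 0\<^sub>v n $ i" using zero by simp
    qed (use A in auto)
    then have "x = 0\<^sub>v nc" by (intro ker) (auto simp: x_def)
    show "\<forall>v\<in>col A ` J. c v = 0"
    proof
      fix v assume "v \<in> col A ` J"
      then obtain j where j: "j \<in> J" "v = col A j" by auto
      then have "j < nc" using J by auto
      moreover from \<open>x = 0\<^sub>v nc\<close> have "x $ j = 0\<^sub>v nc $ j" by simp
      ultimately show "c v = 0" using j by (simp add: x_def)
    qed
  qed (use fin in auto)
  from rank_ge_card_indpt[OF A sub this] show ?thesis
    by (simp add: card_image[OF inj])
qed

section \<open>Closed index sets\<close>

text \<open>In the digraph with an edge from \<open>i\<close> to \<open>j\<close> whenever
  \<open>A $$ (i, j)\<close> is nonzero, these are the vertex sets without outgoing edges. The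
  minimal nonempty ones are the terminal strongly connected components.\<close>

definition closed_set :: "int mat \<Rightarrow> nat set \<Rightarrow> bool" where
  "closed_set A C \<longleftrightarrow> C \<subseteq> {..<dim_row A} \<and> (\<forall>i\<in>C. \<forall>j<dim_row A. A $$ (i, j) \<noteq> 0 \<longrightarrow> j \<in> C)"

definition minimal_closed_set :: "int mat \<Rightarrow> nat set \<Rightarrow> bool" where
  "minimal_closed_set A C \<longleftrightarrow>
     closed_set A C \<and> C \<noteq> {} \<and> (\<forall>B. closed_set A B \<longrightarrow> B \<noteq> {} \<longrightarrow> B \<subseteq> C \<longrightarrow> B = C)"

text \<open>Closed sets are stable under intersection, so a nonempty intersection would equal both
  sets by minimality.\<close>

lemma minimal_closed_set_disjoint:
  assumes "minimal_closed_set A C" "minimal_closed_set A D" "C \<noteq> D"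
  shows "C \<inter> D = {}"
proof -
  have "closed_set A (C \<inter> D)"
    using assms(1,2) by (auto simp: minimal_closed_set_def closed_set_def)
  then show ?thesis
    using assms by (metis inf_le1 inf_le2 minimal_closed_set_def)
qed

lemma ex_minimal_closed_subset:
  assumes "closed_set A C" "C \<noteq> {}"
  obtains D where "minimal_closed_set A D" "D \<subseteq> C"
proof -
  have "finite C" using assms(1) finite_subset by (auto simp: closed_set_def)
  then have "\<exists>D. minimal_closed_set A D \<and> D \<subseteq> C" using assms
  proof (induction C rule: finite_psubset_induct)
    case (psubset C)
    show ?case
    proof (cases "minimal_closed_set A C")
      case False
      then obtain B where "closed_set A B" "B \<noteq> {}" "B \<subset> C"
        using psubset.prems unfolding minimal_closed_set_def by blast
      with psubset.IH[of B] show ?thesis by blast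
    qed blast
  qed
  with that show ?thesis by blast
qed

lemma finite_minimal_closed_sets: "finite {C. minimal_closed_set A C}"
  by (rule finite_subset[of _ "Pow {..<dim_row A}"])
     (auto simp: minimal_closed_set_def closed_set_def)

section \<open>Maximum principle and the dimension of the kernel\<close>

lemma pseudo_principal_matrix_row_sum:
  assumes "pseudo_principal_matrix a A" "i < dim_vec a"
  shows "(\<Sum>j<dim_vec a. A $$ (i, j) * a $ j) = 0"
proof -
  have A: "A \<in> carrier_mat (dim_vec a) (dim_vec a)" and 0: "A *\<^sub>v a = 0\<^sub>v (dim_vec a)"
    using assms(1) by (auto simp: pseudo_principal_matrix_def Let_def)
  have "(\<Sum>j<dim_vec a. A $$ (i, j) * a $ j) = (A *\<^sub>v a) $ i"
    using A assms(2) by (simp add: scalar_prod_def atLeast0LessThan)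
  then show ?thesis using 0 assms(2) by simp
qed

text \<open>Maximum principle: \<open>A\<close> acts on \<open>(a\<^sub>j y\<^sub>j)\<^sub>j\<close> as a weighted graph Laplacian acts on \<open>y\<close>.\<close>

lemma closed_set_argmax:
  fixes y :: "nat \<Rightarrow> rat"
  assumes P: "pseudo_principal_matrix a A"
    and ker: "\<And>i. i < dim_vec a \<Longrightarrow> (\<Sum>j<dim_vec a. of_int (A $$ (i, j) * a $ j) * y j) = 0"
    and max: "\<And>j. j < dim_vec a \<Longrightarrow> y j \<le> m"
  shows "closed_set A {i. i < dim_vec a \<and> y i = m}"
proof -
  let ?n = "dim_vec a"
  have dim: "dim_row A = ?n" using P by (auto simp: pseudo_principal_matrix_def Let_def)
  have "y j = m" if i: "i < ?n" "y i = m" and j: "j < ?n" "A $$ (i, j) \<noteq> 0" for i j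
  proof -
    \<comment> \<open>The \<open>f k\<close> sum to 0 by the row relation for \<open>a\<close> and
      the kernel relation for \<open>y\<close>. Each is nonnegative: off the diagonal by the signs,
      and at \<open>i\<close> because \<open>m - y i = 0\<close> cancels the negative entry. Hence
      every one of them vanishes.\<close>
    define f where "f j = of_int (A $$ (i, j) * a $ j) * (m - y j)" for j
    have nonneg: "0 \<le> f k" if k: "k < ?n" for k
    proof (cases "k = i")
      case False
      then have "0 \<le> A $$ (i, k)" "0 < a $ k"
        using P i k by (auto simp: pseudo_principal_matrix_def Let_def)
      then show ?thesis using max[OF k] unfolding f_def
        by (intro mult_nonneg_nonneg) auto
    qed (simp add: f_def i)
    have "(\<Sum>j<?n. f j) = of_int (\<Sum>j<?n. A $$ (i, j) * a $ j) * m -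
        (\<Sum>j<?n. of_int (A $$ (i, j) * a $ j) * y j)"
      by (simp add: f_def right_diff_distrib sum_subtractf sum_distrib_right)
    also have "\<dots> = 0"
      using pseudo_principal_matrix_row_sum[OF P i(1)] ker[OF i(1)] by simp
    finally have "f j = 0"
      using nonneg j(1) by (subst (asm) sum_nonneg_eq_0_iff) auto
    moreover have "a $ j \<noteq> 0" using P j by (auto simp: pseudo_principal_matrix_def Let_def)
    ultimately show ?thesis using j(2) by (simp add: f_def)
  qed
  then show ?thesis by (auto simp: closed_set_def dim)
qed

text \<open>The indices where \<open>y\<close> is maximal form a closed set, which contains a
  minimal one; some index there has \<open>y i \<le> 0\<close>, so the maximum itself is at most
  0.\<close>

lemma kernel_nonpos_if_nonpos_on_reps:
  fixes y :: "nat \<Rightarrow> rat"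
  assumes P: "pseudo_principal_matrix a A"
    and ker: "\<And>i. i < dim_vec a \<Longrightarrow> (\<Sum>j<dim_vec a. of_int (A $$ (i, j) * a $ j) * y j) = 0"
    and reps: "\<And>C. minimal_closed_set A C \<Longrightarrow> \<exists>i\<in>C. y i \<le> 0"
    and i: "i < dim_vec a"
  shows "y i \<le> 0"
proof -
  define m where "m = Max (y ` {..<dim_vec a})"
  have le: "y j \<le> m" if "j < dim_vec a" for j using that by (simp add: m_def)
  have "m \<in> y ` {..<dim_vec a}" unfolding m_def using i by (intro Max_in) auto
  then have "{i. i < dim_vec a \<and> y i = m} \<noteq> {}" by auto
  moreover have "closed_set A {i. i < dim_vec a \<and> y i = m}"
    using ker le by (intro closed_set_argmax[OF P]) auto
  ultimately obtain C
    where "minimal_closed_set A C" "C \<subseteq> {i. i < dim_vec a \<and> y i = m}"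
    using ex_minimal_closed_subset by metis
  with reps[of C] have "m \<le> 0" by auto
  with le[OF i] show ?thesis by simp
qed

text \<open>A kernel vector that vanishes at one representative of each minimal closed set is zero,
  so the columns at all remaining indices are independent.\<close>

lemma nullity_le_card_minimal_closed_sets:
  assumes P: "pseudo_principal_matrix a A"
  shows "dim_vec a \<le> int_mat_rank A + card {C. minimal_closed_set A C}"
proof -
  let ?n = "dim_vec a" and ?A = "map_mat rat_of_int A" and ?M = "{C. minimal_closed_set A C}"
  have A: "A \<in> carrier_mat ?n ?n" using P by (auto simp: pseudo_principal_matrix_def Let_def)
  then have dim: "dim_row A = ?n" by simp
  have pos: "0 < a $ j" if "j < ?n" for j
    using P that by (auto simp: pseudo_principal_matrix_def Let_def)
  define rep :: "nat set \<Rightarrow> nat" where "rep C = (SOME i. i \<in> C)" for C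
  have rep: "rep C \<in> C" if "minimal_closed_set A C" for C
    using that some_in_eq by (auto simp: rep_def minimal_closed_set_def)
  define J where "J = {..<?n} - rep ` ?M"
  interpret vec_space "TYPE(rat)" ?n .
  have "card J \<le> rank ?A"
  proof (rule rank_ge_card_cols[of _ ?n])
    fix x :: "rat vec"
    assume x: "x \<in> carrier_vec ?n" "?A *\<^sub>v x = 0\<^sub>v ?n" and x0: "\<forall>j\<in>{..<?n} - J. x $ j = 0"
    \<comment> \<open>Dividing by the entries of \<open>a\<close> turns the kernel vector
      \<open>a\<close> into a constant function, the form in which the maximum principle
      applies.\<close>
    define y where "y j = x $ j / of_int (a $ j)" for j
    have ker: "(\<Sum>j<?n. of_int (A $$ (i, j) * a $ j) * y j) = 0" if i: "i < ?n" for i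
    proof -
      have "(\<Sum>j<?n. of_int (A $$ (i, j) * a $ j) * y j) = (\<Sum>j<?n. of_int (A $$ (i, j)) * x $ j)"
        using pos by (intro sum.cong) (force simp: y_def)+
      also have "\<dots> = (?A *\<^sub>v x) $ i"
        using A x(1) i by (simp add: scalar_prod_def atLeast0LessThan)
      finally show ?thesis using x i by simp
    qed
    have y0: "y (rep C) = 0" if "minimal_closed_set A C" for C
    proof -
      have "rep C < ?n" using rep[OF that] that
        by (auto simp: minimal_closed_set_def closed_set_def dim)
      then have "rep C \<in> {..<?n} - J" using that by (auto simp: J_def)
      then show ?thesis using x0 by (simp add: y_def)
    qed
    show "x = 0\<^sub>v ?n"
    proof (rule eq_vecI)
      fix i assume "i < dim_vec (0\<^sub>v ?n :: rat vec)"
      then have i: "i < ?n" by simp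
      have "y i \<le> 0"
        using rep y0 by (intro kernel_nonpos_if_nonpos_on_reps[OF P ker _ i]) force+
      \<comment> \<open>The kernel is stable under negation, so the one-sided bound also applies to
        \<open>- y\<close>.\<close>
      moreover have "- y i \<le> 0"
        using rep y0 ker
        by (intro kernel_nonpos_if_nonpos_on_reps[OF P _ _ i, of "\<lambda>i. - y i"])
           (force simp: sum_negf)+
      ultimately have "y i = 0" by simp
      then show "x $ i = 0\<^sub>v ?n $ i" using pos[OF i] i by (simp add: y_def)
    qed (use x in simp)
  qed (use A in \<open>auto simp: J_def\<close>)
  moreover have "?n - card ?M \<le> card J"
  proof -
    \<comment> \<open>Choosing one representative per set hits at most \<open>card ?M\<close>
      indices, so at most that many are missing from \<open>J\<close>.\<close>
    have "?n - card (rep ` ?M) \<le> card J"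
      unfolding J_def using diff_card_le_card_Diff[of "rep ` ?M" "{..<?n}"]
        finite_minimal_closed_sets by simp
    then show ?thesis using card_image_le[OF finite_minimal_closed_sets[of A], of rep] by linarith
  qed
  ultimately show ?thesis by (simp add: int_mat_rank_def dim)
qed

section \<open>Monoids and minimal generation\<close>

text \<open>Disjointness allows two coefficient functions to be glued into one. Consequently a set
  of generators can be exchanged for another one with the same monoid while the others stay
  fixed.\<close>

lemma gen_monoid_Un_disjoint:
  assumes "finite S" "finite T" "S \<inter> T = {}"
  shows "gen_monoid (S \<union> T) = {x + y | x y. x \<in> gen_monoid S \<and> y \<in> gen_monoid T}" (is "?L = ?R")
proof
  show "?L \<subseteq> ?R"
    unfolding gen_monoid_def sum.union_disjoint[OF assms] by blast
  show "?R \<subseteq> ?L"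
  proof
    fix z assume "z \<in> ?R"
    then obtain k l where z: "z = (\<Sum>x\<in>S. int (k x) * x) + (\<Sum>x\<in>T. int (l x) * x)"
      by (auto simp: gen_monoid_def)
    define h where "h x = (if x \<in> S then k x else l x)" for x
    have "(\<Sum>x\<in>S. int (h x) * x) = (\<Sum>x\<in>S. int (k x) * x)"
      by (intro sum.cong) (auto simp: h_def)
    moreover have "(\<Sum>x\<in>T. int (h x) * x) = (\<Sum>x\<in>T. int (l x) * x)"
      using assms(3) by (intro sum.cong) (auto simp: h_def)
    ultimately have "z = (\<Sum>x\<in>S \<union> T. int (h x) * x)"
      using assms z by (simp add: sum.union_disjoint)
    then show "z \<in> ?L" by (auto simp: gen_monoid_def)
  qed
qed

lemma gen_monoid_mono:
  assumes "finite T" "S \<subseteq> T"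
  shows "gen_monoid S \<subseteq> gen_monoid T"
proof
  fix x assume x: "x \<in> gen_monoid S"
  have "0 \<in> gen_monoid (T - S)"
    by (auto simp: gen_monoid_def intro!: exI[of _ "\<lambda>_. 0"])
  moreover have "finite S" using assms finite_subset by blast
  ultimately have "x \<in> gen_monoid (S \<union> (T - S))"
    unfolding gen_monoid_Un_disjoint[OF \<open>finite S\<close> finite_Diff[OF assms(1)] Diff_disjoint]
    using x by (intro CollectI exI[of _ x] exI[of _ 0]) simp
  moreover have "S \<union> (T - S) = T" using assms(2) by auto
  ultimately show "x \<in> gen_monoid T" by simp
qed

text \<open>A redundancy among the entries of \<open>v\<close>, completed on both sides by the
  remaining entries of \<open>a\<close>, would be a redundancy of \<open>a\<close>.\<close>

lemma minimally_generates_subset: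
  assumes min: "minimally_generates a" and v: "distinct (list_of_vec v)" "set\<^sub>v v \<subseteq> set\<^sub>v a"
  shows "minimally_generates v"
  unfolding minimally_generates_def
proof (intro conjI allI impI notI)
  fix B assume B: "B \<subset> set\<^sub>v v" and eq: "gen_monoid B = gen_monoid (set\<^sub>v v)"
  let ?R = "set\<^sub>v a - set\<^sub>v v"
  have "finite (set\<^sub>v a)" "finite (set\<^sub>v v)" by (simp_all add: vec_set_def)
  moreover from this have "finite B" using B finite_subset by blast
  moreover have "B \<inter> ?R = {}" "set\<^sub>v v \<inter> ?R = {}" using B by auto
  ultimately have "gen_monoid (B \<union> ?R) = gen_monoid (set\<^sub>v v \<union> ?R)"
    using eq by (simp only: gen_monoid_Un_disjoint finite_Diff)
  moreover have "set\<^sub>v v \<union> ?R = set\<^sub>v a" using v by auto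
  moreover have "B \<union> ?R \<subset> set\<^sub>v a" using B v by auto
  ultimately show False using min by (auto simp: minimally_generates_def)
qed (use v in simp)

text \<open>Row \<open>i\<close> of the relation \<open>P v = 0\<close> is solved for its diagonal
  term; the other terms have nonnegative coefficients.\<close>

lemma diagonal_multiple_in_gen_monoid:
  assumes v: "distinct (list_of_vec v)" and P: "P \<in> carrier_mat (dim_vec v) (dim_vec v)"
    and nonneg: "\<And>j. j < dim_vec v \<Longrightarrow> j \<noteq> i \<Longrightarrow> 0 \<le> P $$ (i, j)"
    and zero: "P *\<^sub>v v = 0\<^sub>v (dim_vec v)" and i: "i < dim_vec v"
  shows "- P $$ (i, i) * v $ i \<in> gen_monoid (set\<^sub>v v - {v $ i})"
proof -
  let ?J = "{..<dim_vec v} - {i}"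
  have inj: "inj_on (($) v) {..<dim_vec v}"
    using v by (auto simp: inj_on_def distinct_conv_nth list_of_vec_index)
  \<comment> \<open>\<open>gen_monoid\<close> indexes coefficients by values rather than positions,
    hence the inverse of the injective map \<open>($) v\<close>. Truncation by \<open>nat\<close> is
    harmless off the diagonal.\<close>
  define k where "k x = nat (P $$ (i, the_inv_into {..<dim_vec v} (($) v) x))" for x
  have k: "int (k (v $ j)) = P $$ (i, j)" if "j \<in> ?J" for j
    using that nonneg[of j] the_inv_into_f_f[OF inj, of j] by (simp add: k_def)
  have "0 = (P *\<^sub>v v) $ i" using zero i by simp
  also have "\<dots> = (\<Sum>j<dim_vec v. P $$ (i, j) * v $ j)"
    using P i by (simp add: scalar_prod_def atLeast0LessThan)
  also have "\<dots> = P $$ (i, i) * v $ i + (\<Sum>j\<in>?J. P $$ (i, j) * v $ j)"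
    using i by (subst sum.remove[of _ i]) auto
  finally have "- P $$ (i, i) * v $ i = (\<Sum>j\<in>?J. P $$ (i, j) * v $ j)" by simp
  also have "\<dots> = (\<Sum>j\<in>?J. int (k (v $ j)) * v $ j)" using k by (intro sum.cong) auto
  also have "\<dots> = (\<Sum>x\<in>($) v ` ?J. int (k x) * x)"
    by (subst sum.reindex) (auto intro: inj_on_subset[OF inj])
  also have "($) v ` ?J = set\<^sub>v v - {v $ i}"
    using inj_on_image_set_diff[OF inj, of "{..<dim_vec v}" "{i}"] i by (simp add: vec_set_def)
  finally show ?thesis by (auto simp: gen_monoid_def)
qed

section \<open>Submatrices along index lists\<close>

text \<open>Lists rather than sets record the order of rows and columns, so appending lists yields
  block matrices and a list of all indices yields a simultaneous permutation.\<close>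

definition submat :: "'a mat \<Rightarrow> nat list \<Rightarrow> nat list \<Rightarrow> 'a mat" where
  "submat A xs ys = mat (length xs) (length ys) (\<lambda>(i, j). A $$ (xs ! i, ys ! j))"

lemma submat_carrier: "submat A xs ys \<in> carrier_mat (length xs) (length ys)"
  by (simp add: submat_def)

lemma submat_append:
  "submat A (xs @ xs') (ys @ ys') =
     four_block_mat (submat A xs ys) (submat A xs ys') (submat A xs' ys) (submat A xs' ys')"
  by (rule eq_matI) (auto simp: submat_def nth_append)

lemma submat_eq_0:
  assumes "\<And>x y. x \<in> set xs \<Longrightarrow> y \<in> set ys \<Longrightarrow> A $$ (x, y) = 0"
  shows "submat A xs ys = 0\<^sub>m (length xs) (length ys)"
  using assms by (intro eq_matI) (auto simp: submat_def)

text \<open>The rows of every list vanish on the columns of all the other lists, so both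
  off-diagonal blocks are zero when the first list is split off.\<close>

lemma submat_concat_eq_diag_block_mat:
  assumes "distinct (concat xss)"
    and "\<And>xs x y. xs \<in> set xss \<Longrightarrow> x \<in> set xs \<Longrightarrow> y \<in> set (concat xss) \<Longrightarrow> y \<notin> set xs \<Longrightarrow> A $$ (x, y) = 0"
  shows "submat A (concat xss) (concat xss) = diag_block_mat (map (\<lambda>xs. submat A xs xs) xss)"
  using assms
proof (induction xss)
  case Nil
  show ?case by (auto simp: submat_def)
next
  case (Cons xs xss)
  have disj: "set xs \<inter> set (concat xss) = {}" using Cons.prems(1) by auto
  have IH: "submat A (concat xss) (concat xss) = diag_block_mat (map (\<lambda>xs. submat A xs xs) xss)"
    using Cons.prems by (intro Cons.IH) auto
  have ur: "submat A xs (concat xss) = 0\<^sub>m (length xs) (length (concat xss))"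
    using disj by (intro submat_eq_0 Cons.prems(2)[of xs]) auto
  have ll: "submat A (concat xss) xs = 0\<^sub>m (length (concat xss)) (length xs)"
  proof (rule submat_eq_0)
    fix x y assume "x \<in> set (concat xss)" "y \<in> set xs"
    then obtain ys where "ys \<in> set xss" "x \<in> set ys" by auto
    with \<open>y \<in> set xs\<close> disj show "A $$ (x, y) = 0" by (intro Cons.prems(2)[of ys]) auto
  qed
  show ?case
    by (simp only: concat.simps list.map diag_block_mat.simps Let_def submat_append ur ll flip: IH)
       (simp add: submat_def)
qed

text \<open>The list is the one-line notation of the permutation; \<open>permutes\<close> requires
  the identity outside \<open>{..<n}\<close>.\<close>

lemma permutes_nth:
  assumes "distinct xs" "set xs = {..<n}"
  shows "(\<lambda>i. if i < n then xs ! i else i) permutes {..<n}"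
proof -
  have len: "length xs = n" using assms distinct_card[of xs] by simp
  have "bij_betw ((!) xs) {..<n} {..<n}"
    by (rule bij_betw_nth) (use assms len in simp_all)
  moreover have "bij_betw (\<lambda>i. if i < n then xs ! i else i) {..<n} {..<n} \<longleftrightarrow> bij_betw ((!) xs) {..<n} {..<n}"
    by (rule bij_betw_cong) simp
  ultimately show ?thesis by (intro bij_imp_permutes) auto
qed

section \<open>Blocks on closed sets\<close>

text \<open>A row from \<open>C\<close> is zero outside \<open>C\<close>, so its full relation
  already lives on \<open>C\<close>.\<close>

lemma closed_set_row_sum:
  assumes P: "pseudo_principal_matrix a A" and C: "closed_set A C" "i \<in> C"
  shows "(\<Sum>j\<in>C. A $$ (i, j) * a $ j) = 0"
proof -
  have dim: "dim_row A = dim_vec a" using P by (auto simp: pseudo_principal_matrix_def Let_def)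
  then have "(\<Sum>j\<in>C. A $$ (i, j) * a $ j) = (\<Sum>j<dim_vec a. A $$ (i, j) * a $ j)"
    using C by (intro sum.mono_neutral_left) (auto simp: closed_set_def)
  also have "\<dots> = 0"
    using C dim by (intro pseudo_principal_matrix_row_sum[OF P]) (auto simp: closed_set_def)
  finally show ?thesis .
qed

text \<open>On a singleton the row relation would reduce to a negative diagonal entry times a
  positive integer. This is the source of the bound on the block sizes.\<close>

lemma closed_set_card_ge_2:
  assumes P: "pseudo_principal_matrix a A" and C: "closed_set A C" "C \<noteq> {}"
  shows "2 \<le> card C"
proof -
  have "finite C" using C finite_subset by (auto simp: closed_set_def)
  then have "card C \<noteq> 0" using C by simp
  moreover have "card C \<noteq> 1"
  proof
    assume "card C = 1"
    then obtain i where i: "C = {i}" by (auto simp: card_1_singleton_iff)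
    with closed_set_row_sum[OF P C(1), of i] have "A $$ (i, i) * a $ i = 0" by simp
    moreover have "i < dim_vec a"
      using P C i by (auto simp: closed_set_def pseudo_principal_matrix_def Let_def)
    ultimately show False using P by (auto simp: pseudo_principal_matrix_def Let_def)
  qed
  ultimately show ?thesis by linarith
qed

definition subvec :: "'a vec \<Rightarrow> nat list \<Rightarrow> 'a vec" where
  "subvec a xs = vec (length xs) (\<lambda>i. a $ (xs ! i))"

lemma list_of_subvec: "list_of_vec (subvec a xs) = map (($) a) xs"
  by (rule nth_equalityI) (simp_all add: subvec_def)

lemma pseudo_principal_submat:
  assumes P: "pseudo_principal_matrix a A" and C: "closed_set A (set xs)" and xs: "distinct xs"
  shows "pseudo_principal_matrix (subvec a xs) (submat A xs xs)"
proof -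
  let ?n = "dim_vec a" and ?m = "length xs"
  have dim: "dim_row A = ?n" using P by (auto simp: pseudo_principal_matrix_def Let_def)
  have lt: "xs ! i < ?n" if "i < ?m" for i
    using C nth_mem[OF that] unfolding closed_set_def dim by blast
  have "submat A xs xs *\<^sub>v subvec a xs = 0\<^sub>v ?m"
  proof (rule eq_vecI)
    fix i assume "i < dim_vec (0\<^sub>v ?m :: int vec)"
    then have i: "i < ?m" by simp
    have "(submat A xs xs *\<^sub>v subvec a xs) $ i = (\<Sum>j<?m. A $$ (xs ! i, xs ! j) * a $ (xs ! j))"
      using i by (simp add: submat_def subvec_def scalar_prod_def atLeast0LessThan)
    \<comment> \<open>Positions are traded for indices, so that the row relation on the closed set
      applies.\<close>
    also have "\<dots> = (\<Sum>j\<in>set xs. A $$ (xs ! i, j) * a $ j)"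
      by (rule sum.reindex_bij_betw[OF bij_betw_nth[OF xs refl refl]])
    also have "\<dots> = 0" using i by (intro closed_set_row_sum[OF P C]) simp
    finally show "(submat A xs xs *\<^sub>v subvec a xs) $ i = 0\<^sub>v ?m $ i" using i by simp
  qed (simp add: submat_def)
  then show ?thesis
    using P lt nth_eq_iff_index_eq[OF xs]
    by (simp add: pseudo_principal_matrix_def Let_def submat_def subvec_def)
qed

text \<open>The multiplier for \<open>a\<close> only gives membership in the larger monoid, so
  membership for the block comes from the block's own relation. The lower bound passes down because
  the block's monoid is contained in the larger one.\<close>

lemma principal_submat:
  assumes P: "pseudo_principal_matrix a A" and prin: "principal_matrix a A"
    and C: "closed_set A (set xs)" and xs: "distinct xs"
  shows "principal_matrix (subvec a xs) (submat A xs xs)"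
proof -
  let ?n = "dim_vec a" and ?v = "subvec a xs" and ?P = "submat A xs xs"
  have sub: "pseudo_principal_matrix ?v ?P" by (rule pseudo_principal_submat[OF P C xs])
  have dv: "dim_vec ?v = length xs" by (simp add: subvec_def)
  have min: "minimally_generates a"
    and mult: "i < ?n \<Longrightarrow> smallest_multiplier a i (- A $$ (i, i))" for i
    using prin by (auto simp: principal_matrix_def Let_def)
  have lt: "x < ?n" if "x \<in> set xs" for x
    using P C that by (auto simp: closed_set_def pseudo_principal_matrix_def Let_def)
  have inj: "inj_on (($) a) {..<?n}"
    using min by (auto simp: minimally_generates_def inj_on_def distinct_conv_nth list_of_vec_index)
  have dist: "distinct (list_of_vec ?v)"
    using xs lt inj by (auto simp: list_of_subvec distinct_map intro: inj_on_subset)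
  have sv: "set\<^sub>v ?v \<subseteq> set\<^sub>v a"
    unfolding set_list_of_vec[symmetric, of ?v] list_of_subvec using lt by (auto simp: vec_set_def)
  have "smallest_multiplier ?v i (- ?P $$ (i, i))" if i: "i < dim_vec ?v" for i
  proof -
    have eq: "?P $$ (i, i) = A $$ (xs ! i, xs ! i)" "?v $ i = a $ (xs ! i)"
      using i by (simp_all add: submat_def subvec_def)
    have "0 < - ?P $$ (i, i)"
      using sub i by (auto simp: pseudo_principal_matrix_def Let_def)
    moreover have "- ?P $$ (i, i) * ?v $ i \<in> gen_monoid (set\<^sub>v ?v - {?v $ i})"
      using sub i
      by (intro diagonal_multiple_in_gen_monoid[OF dist]) (auto simp: pseudo_principal_matrix_def Let_def)
    moreover have "gen_monoid (set\<^sub>v ?v - {?v $ i}) \<subseteq> gen_monoid (set\<^sub>v a - {?v $ i})"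
      using sv by (intro gen_monoid_mono) (auto simp: vec_set_def)
    moreover have "smallest_multiplier a (xs ! i) (- ?P $$ (i, i))"
      unfolding eq using i dv by (intro mult lt) simp
    ultimately show ?thesis
      unfolding smallest_multiplier_def eq by blast
  qed
  then show ?thesis
    using sub minimally_generates_subset[OF min dist sv]
    by (simp add: principal_matrix_def pseudo_principal_matrix_def Let_def)
qed

section \<open>Assembly of the block form\<close>

theorem theorem13:
  fixes n p :: nat and a :: "int vec" and A :: "int mat"
  assumes "a \<in> carrier_vec n"
    and "A \<in> carrier_mat n n"
    and "pseudo_principal_matrix a A"
    and "int (int_mat_rank A) = int n - int p"
    and "int n - int p \<le> int n - 2"
  shows "\<exists>r :: nat list. length r = p \<and> (\<forall>i<p. 2 \<le> r ! i) \<and> sum_list r \<le> n \<and>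
    (\<exists>\<pi> (parts :: int vec list) (rest :: int vec) (Ps :: int mat list) A1 A2.
       \<pi> permutes {..<n} \<and>
       length parts = p \<and> (\<forall>i<p. parts ! i \<in> carrier_vec (r ! i)) \<and>
       list_of_vec (reorder_vec \<pi> a) = concat (map list_of_vec parts) @ list_of_vec rest \<and>
       length Ps = p \<and> (\<forall>i<p. Ps ! i \<in> carrier_mat (r ! i) (r ! i)) \<and>
       A1 \<in> carrier_mat (n - sum_list r) (sum_list r) \<and>
       A2 \<in> carrier_mat (n - sum_list r) (n - sum_list r) \<and>
       reorder_mat \<pi> A =
         four_block_mat (diag_block_mat Ps) (0\<^sub>m (sum_list r) (n - sum_list r)) A1 A2 \<and>
       (\<forall>i<p. pseudo_principal_matrix (parts ! i) (Ps ! i)) \<and>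
       (principal_matrix a A \<longrightarrow> (\<forall>i<p. principal_matrix (parts ! i) (Ps ! i))))"
proof -
  note P = assms(3)
  have dim: "dim_vec a = n" "dim_row A = n" "dim_col A = n" using assms(1,2) by auto
  \<comment> \<open>The nullity is \<open>p\<close>, so \<open>p\<close> minimal closed sets can be
    selected as the blocks.\<close>
  have "p \<le> card {C. minimal_closed_set A C}"
    using nullity_le_card_minimal_closed_sets[OF P] assms(4) dim by linarith
  then obtain S where S: "S \<subseteq> {C. minimal_closed_set A C}" "card S = p" "finite S"
    by (rule obtain_subset_with_card_n)
  then obtain Cs where Cs: "set Cs = S" "distinct Cs" using finite_distinct_list by blast
  then have lenCs: "length Cs = p" using S distinct_card[of Cs] by simp
  have minimal: "minimal_closed_set A C" if "C \<in> set Cs" for C using that S Cs by auto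
  then have finC: "finite C" and sub: "C \<subseteq> {..<n}" if "C \<in> set Cs" for C
    using that finite_subset by (auto simp: minimal_closed_set_def closed_set_def dim)
  define xss where "xss = map sorted_list_of_set Cs"
  have xss: "closed_set A (set xs)" "set xs \<noteq> {}" "distinct xs" if "xs \<in> set xss" for xs
    using that minimal finC by (auto simp: xss_def minimal_closed_set_def)
  have len: "length xss = p" by (simp add: xss_def lenCs)
  have "distinct (concat xss)"
  proof (rule distinct_concat)
    \<comment> \<open>On finite sets \<open>set\<close> is a left inverse, so different blocks give
      different lists.\<close>
    have "inj_on sorted_list_of_set (set Cs)"
      by (rule inj_on_inverseI[of _ set]) (use finC in simp)
    then show "distinct xss" using Cs by (simp add: xss_def distinct_map)
    show "set xs \<inter> set ys = {}" if "xs \<in> set xss" "ys \<in> set xss" "xs \<noteq> ys" for xs ys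
      using that minimal finC minimal_closed_set_disjoint by (fastforce simp: xss_def)
  qed (rule xss)
  \<comment> \<open>The last, possibly empty, part takes every index outside the selected
    sets.\<close>
  define zs where "zs = sorted_list_of_set ({..<n} - set (concat xss))"
  let ?L = "concat xss @ zs"
  have L: "distinct ?L" "set ?L = {..<n}"
    using \<open>distinct (concat xss)\<close> sub finC by (auto simp: zs_def xss_def)
  then have lenL: "length ?L = n" using distinct_card[of ?L] by simp
  define r where "r = map length xss"
  have sum_r: "sum_list r = length (concat xss)" by (simp add: r_def length_concat)
  have len_zs: "n - sum_list r = length zs" using lenL sum_r by simp
  define \<pi> where "\<pi> i = (if i < n then ?L ! i else i)" for i
  define Ps where "Ps = map (\<lambda>xs. submat A xs xs) xss"
  let ?parts = "map (subvec a) xss"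
  have perm: "\<pi> permutes {..<n}" unfolding \<pi>_def using permutes_nth[OF L] .
  have "list_of_vec (reorder_vec \<pi> a) = map (($) a) ?L"
    using lenL by (intro nth_equalityI) (simp_all add: reorder_vec_def \<pi>_def dim del: map_append)
  then have vec: "list_of_vec (reorder_vec \<pi> a)
      = concat (map list_of_vec ?parts) @ list_of_vec (subvec a zs)"
    by (simp add: list_of_subvec map_concat o_def)
  have diag: "submat A (concat xss) (concat xss) = diag_block_mat Ps"
    unfolding Ps_def
  proof (rule submat_concat_eq_diag_block_mat[OF \<open>distinct (concat xss)\<close>])
    \<comment> \<open>Each block is closed, so its rows vanish on the columns of the other blocks;
      the same reason gives the zero block over \<open>zs\<close> below.\<close>
    fix xs x y assume "xs \<in> set xss" "x \<in> set xs" "y \<in> set (concat xss)" "y \<notin> set xs"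
    moreover from this have "y < n" using L by auto
    ultimately show "A $$ (x, y) = 0" using xss(1)[of xs] by (auto simp: closed_set_def dim)
  qed
  have ur: "submat A (concat xss) zs = 0\<^sub>m (sum_list r) (n - sum_list r)"
    unfolding sum_r len_zs[unfolded sum_r]
  proof (rule submat_eq_0)
    fix x y assume "x \<in> set (concat xss)" and y: "y \<in> set zs"
    then obtain xs where xs: "xs \<in> set xss" "x \<in> set xs" by auto
    moreover have "y < n" "y \<notin> set xs" using y xs L by auto
    ultimately show "A $$ (x, y) = 0" using xss(1)[of xs] by (auto simp: closed_set_def dim)
  qed
  have "reorder_mat \<pi> A = submat A ?L ?L"
    using lenL by (intro eq_matI) (simp_all add: reorder_mat_def submat_def \<pi>_def dim)
  then have mat: "reorder_mat \<pi> A = four_block_mat (diag_block_mat Ps)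
      (0\<^sub>m (sum_list r) (n - sum_list r)) (submat A zs (concat xss)) (submat A zs zs)"
    by (simp add: submat_append diag ur)
  show ?thesis
  proof (intro exI[of _ r] exI[of _ \<pi>] exI[of _ ?parts] exI[of _ "subvec a zs"] exI[of _ Ps]
      exI conjI perm vec)
    \<comment> \<open>The witnesses for \<open>A1\<close> and \<open>A2\<close> were left schematic;
      this first goal fixes them as the two submatrices on the rows \<open>zs\<close>.\<close>
    show "reorder_mat \<pi> A = four_block_mat (diag_block_mat Ps)
        (0\<^sub>m (sum_list r) (n - sum_list r)) (submat A zs (concat xss)) (submat A zs zs)"
      by (rule mat)
    show "\<forall>i<p. 2 \<le> r ! i"
    proof (intro allI impI)
      fix i assume "i < p"
      then have "xss ! i \<in> set xss" using len by simp
      from closed_set_card_ge_2[OF P xss(1,2)[OF this]] xss(3)[OF this]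
      show "2 \<le> r ! i" using \<open>i < p\<close> len by (simp add: r_def distinct_card)
    qed
    show "principal_matrix a A \<longrightarrow> (\<forall>i<p. principal_matrix (?parts ! i) (Ps ! i))"
      using xss len by (auto simp: Ps_def intro: principal_submat[OF P])
    show "\<forall>i<p. pseudo_principal_matrix (?parts ! i) (Ps ! i)"
      using xss len by (auto simp: Ps_def intro: pseudo_principal_submat[OF P])
    show "submat A zs (concat xss) \<in> carrier_mat (n - sum_list r) (sum_list r)"
      "submat A zs zs \<in> carrier_mat (n - sum_list r) (n - sum_list r)"
      unfolding len_zs unfolding sum_r by (rule submat_carrier)+
    show "sum_list r \<le> n" using lenL sum_r by simp
  qed (use len in \<open>auto simp: r_def Ps_def subvec_def submat_def\<close>)
qed

end
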